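(* Let $\lambda_1,\lambda_2>0$, $0<\omega_{\min}\le\omega_{\max}<1$, and let $W_1,W_2\in\mathbb{R}^{2n\times 2n}$ be fixed diagonal matrices with $\omega_{\min}I\preceq W_i\preceq\omega_{\max}I$, $i=1,2$. For $f\in\mathbb{R}^n$, let $x^\star_f$ denote the unique fixed point, corresponding to the observed image $f$, of the operator $\mathcal{T}_\theta$ with these fixed weights. Then, for all $f_1,f_2\in\mathbb{R}^n$, $$\|x^\star_{f_1}-x^\star_{f_2}\|_2\le\frac{\|S\|}{\alpha}\,\|f_1-f_2\|_2.$$
   Context: Let $h,w\ge 2$ be integers and $n=hw$. For $m\ge 2$ let $B_m\in\mathbb{R}^{m\times m}$ be the matrix with $(B_m z)_i = z_{i+1}-z_i$ for $1\le i\le m-1$ and $(B_m z)_m = z_m-z_{m-1}$. Put $\nabla_x = I_h\otimes B_w$, $\nabla_y = B_h\otimes I_w$, and $\nabla = \begin{bmatrix}\nabla_x\\ \nabla_y\end{bmatrix}\in\mathbb{R}^{2n\times n}$. Define $S=[\,I_n\;\; -\nabla^\top\,]\in\mathbb{R}^{n\times 3n}$, $G=[\,\nabla\;\; 0_{2n\times 2n}\,]\in\mathbb{R}^{2n\times 3n}$, $R=[\,0_{2n\times n}\;\; I_{2n}\,]\in\mathbb{R}^{2n\times 3n}$, and $A(W_1,W_2)=S^\top S+\lambda_1G^\top W_1G+\lambda_2R^\top W_2R$, which is symmetric positive definite for admissible weights. In general $\mathcal{T}_\theta(x)=A(W_1,W_2)^{-1}S^\top f$ (the minimizer over $u\in\mathbb{R}^{3n}$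 of $\frac12\|Su-f\|_2^2+\frac{\lambda_1}{2}(Gu)^\top W_1(Gu)+\frac{\lambda_2}{2}(Ru)^\top W_2(Ru)$), where $(W_1,W_2)$ are the weights associated with $x$. Here the weights are held fixed (the same for all $x$ and all $f$), so the fixed point $x^\star_f$ is the solution of the normal equations $A(W_1,W_2)\,x=S^\top f$. $\alpha:=\sigma_{\min}^2(\mathcal{M})>0$, where $\sigma_{\min}$ is the smallest singular value and $\mathcal{M}=\begin{bmatrix}S\\ \sqrt{\lambda_1\omega_{\min}}\,G\\ \sqrt{\lambda_2\omega_{\min}}\,R\end{bmatrix}$. $\|S\|$ is the spectral norm; $\preceq$ is the Loewner order. *)

theory Defs
  imports
    Complex_Main
    "Jordan_Normal_Form.Matrix"
    "Jordan_Normal_Form.Gauss_Jordan_Elimination"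
    "Jordan_Normal_Form.Char_Poly"
begin

section \<open>Linear algebra\<close>

definition l2norm_vec :: "real vec \<Rightarrow> real" where
  "l2norm_vec v = sqrt (v \<bullet> v)"

text \<open>The spectral norm is the operator norm induced by the Euclidean norms.\<close>

definition spectral_norm :: "real mat \<Rightarrow> real" where
  "spectral_norm A =
     (SUP x \<in> {x \<in> carrier_vec (dim_col A). l2norm_vec x \<le> 1}. l2norm_vec (A *\<^sub>v x))"

text \<open>With multiplicity these are \<open>dim_col A\<close> singular values, which is the usual convention when
  \<open>A\<close> has at least as many rows as columns; a wide \<open>A\<close> always has the singular value \<open>0\<close> here.\<close>

definition singular_values :: "real mat \<Rightarrow> real set" where
  "singular_values A = {sqrt \<mu> | \<mu>. eigenvalue (transpose_mat A * A) \<mu>}"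

definition sigma_min :: "real mat \<Rightarrow> real" where
  "sigma_min A = Min (singular_values A)"

definition pos_semidef :: "real mat \<Rightarrow> bool" where
  "pos_semidef A \<longleftrightarrow>
     square_mat A \<and> transpose_mat A = A \<and> (\<forall>x \<in> carrier_vec (dim_row A). 0 \<le> x \<bullet> (A *\<^sub>v x))"

text \<open>The Loewner order; the library's \<open>\<le>\<close> on matrices is the entrywise order instead.\<close>

definition loewner_le :: "real mat \<Rightarrow> real mat \<Rightarrow> bool" (infix \<open>\<preceq>\<^sub>L\<close> 50) where
  "A \<preceq>\<^sub>L B \<longleftrightarrow> dim_row A = dim_row B \<and> dim_col A = dim_col B \<and> pos_semidef (B - A)"

definition kronecker :: "real mat \<Rightarrow> real mat \<Rightarrow> real mat" (infixl \<open>\<otimes>\<^sub>K\<close> 70) where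
  "A \<otimes>\<^sub>K B = mat (dim_row A * dim_row B) (dim_col A * dim_col B)
     (\<lambda>(i, j). A $$ (i div dim_row B, j div dim_col B) * B $$ (i mod dim_row B, j mod dim_col B))"

definition append_cols :: "real mat \<Rightarrow> real mat \<Rightarrow> real mat" (infixr \<open>@\<^sub>c\<close> 65) where
  "A @\<^sub>c B = four_block_mat A B (0\<^sub>m 0 (dim_col A)) (0\<^sub>m 0 (dim_col B))"

section \<open>The discrete gradient and the variational model\<close>

text \<open>Indices are zero-based. The last row repeats the difference of the row before it.\<close>

definition diff_mat :: "nat \<Rightarrow> real mat" where
  "diff_mat m = mat m m (\<lambda>(i, j).
     let k = (if i + 1 < m then i else m - 2)
     in if j = k + 1 then 1 else if j = k then - 1 else 0)"

lemma diff_mat_mult_vec: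
  assumes "m \<ge> 2" "z \<in> carrier_vec m"
  shows "diff_mat m *\<^sub>v z =
    vec m (\<lambda>i. if i + 1 < m then z $ (i + 1) - z $ i else z $ (m - 1) - z $ (m - 2))"
proof (rule eq_vecI)
  fix i assume "i < dim_vec (vec m (\<lambda>i. if i + 1 < m then z $ (i + 1) - z $ i
    else z $ (m - 1) - z $ (m - 2)))"
  then have i: "i < m" by simp
  define k where "k = (if i + 1 < m then i else m - 2)"
  have k: "k < m" "k + 1 < m" using i assms(1) by (auto simp: k_def)
  have "(diff_mat m *\<^sub>v z) $ i =
      (\<Sum>j\<in>{0..<m}. (if j = k + 1 then 1 else if j = k then - 1 else 0) * z $ j)"
    using i assms(2) by (auto simp: diff_mat_def scalar_prod_def Let_def k_def intro!: sum.cong)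
  also have "\<dots> = (\<Sum>j\<in>{0..<m}. (if j = k + 1 then z $ j else 0) - (if j = k then z $ j else 0))"
    by (intro sum.cong) auto
  also have "\<dots> = z $ (k + 1) - z $ k"
    using k by (simp add: sum_subtractf)
  finally show "(diff_mat m *\<^sub>v z) $ i = vec m (\<lambda>i. if i + 1 < m then z $ (i + 1) - z $ i
      else z $ (m - 1) - z $ (m - 2)) $ i"
    using i assms(1) by (auto simp: k_def numeral_2_eq_2 Suc_diff_Suc)
qed (simp add: diff_mat_def)

definition grad_x :: "nat \<Rightarrow> nat \<Rightarrow> real mat" where
  "grad_x h w = 1\<^sub>m h \<otimes>\<^sub>K diff_mat w"

definition grad_y :: "nat \<Rightarrow> nat \<Rightarrow> real mat" where
  "grad_y h w = diff_mat h \<otimes>\<^sub>K 1\<^sub>m w"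

definition grad :: "nat \<Rightarrow> nat \<Rightarrow> real mat" where
  "grad h w = grad_x h w @\<^sub>r grad_y h w"

definition S_mat :: "nat \<Rightarrow> nat \<Rightarrow> real mat" where
  "S_mat h w = 1\<^sub>m (h * w) @\<^sub>c (- transpose_mat (grad h w))"

definition G_mat :: "nat \<Rightarrow> nat \<Rightarrow> real mat" where
  "G_mat h w = grad h w @\<^sub>c 0\<^sub>m (2 * (h * w)) (2 * (h * w))"

definition R_mat :: "nat \<Rightarrow> nat \<Rightarrow> real mat" where
  "R_mat h w = 0\<^sub>m (2 * (h * w)) (h * w) @\<^sub>c 1\<^sub>m (2 * (h * w))"

definition A_mat :: "nat \<Rightarrow> nat \<Rightarrow> real \<Rightarrow> real \<Rightarrow> real mat \<Rightarrow> real mat \<Rightarrow> real mat" where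
  "A_mat h w lam\<^sub>1 lam\<^sub>2 W\<^sub>1 W\<^sub>2 =
     transpose_mat (S_mat h w) * S_mat h w
     + lam\<^sub>1 \<cdot>\<^sub>m (transpose_mat (G_mat h w) * W\<^sub>1 * G_mat h w)
     + lam\<^sub>2 \<cdot>\<^sub>m (transpose_mat (R_mat h w) * W\<^sub>2 * R_mat h w)"

text \<open>The map \<open>\<W>\<close> assigns to \<open>x\<close> its weights \<open>(W\<^sub>1, W\<^sub>2)\<close>.\<close>

definition T_op :: "nat \<Rightarrow> nat \<Rightarrow> real \<Rightarrow> real \<Rightarrow> (real vec \<Rightarrow> real mat \<times> real mat) \<Rightarrow>
    real vec \<Rightarrow> real vec \<Rightarrow> real vec" where
  "T_op h w lam\<^sub>1 lam\<^sub>2 \<W> f x =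
     the (mat_inverse (A_mat h w lam\<^sub>1 lam\<^sub>2 (fst (\<W> x)) (snd (\<W> x))))
       *\<^sub>v (transpose_mat (S_mat h w) *\<^sub>v f)"

definition is_fixed_point :: "nat \<Rightarrow> nat \<Rightarrow> real \<Rightarrow> real \<Rightarrow> (real vec \<Rightarrow> real mat \<times> real mat) \<Rightarrow>
    real vec \<Rightarrow> real vec \<Rightarrow> bool" where
  "is_fixed_point h w lam\<^sub>1 lam\<^sub>2 \<W> f x \<longleftrightarrow>
     x \<in> carrier_vec (3 * (h * w)) \<and> T_op h w lam\<^sub>1 lam\<^sub>2 \<W> f x = x"

definition fixed_point :: "nat \<Rightarrow> nat \<Rightarrow> real \<Rightarrow> real \<Rightarrow> (real vec \<Rightarrow> real mat \<times> real mat) \<Rightarrow>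
    real vec \<Rightarrow> real vec" where
  "fixed_point h w lam\<^sub>1 lam\<^sub>2 \<W> f = (THE x. is_fixed_point h w lam\<^sub>1 lam\<^sub>2 \<W> f x)"

definition M_mat :: "nat \<Rightarrow> nat \<Rightarrow> real \<Rightarrow> real \<Rightarrow> real \<Rightarrow> real mat" where
  "M_mat h w lam\<^sub>1 lam\<^sub>2 \<omega> =
     S_mat h w @\<^sub>r (sqrt (lam\<^sub>1 * \<omega>) \<cdot>\<^sub>m G_mat h w) @\<^sub>r (sqrt (lam\<^sub>2 * \<omega>) \<cdot>\<^sub>m R_mat h w)"

definition alpha :: "nat \<Rightarrow> nat \<Rightarrow> real \<Rightarrow> real \<Rightarrow> real \<Rightarrow> real" where
  "alpha h w lam\<^sub>1 lam\<^sub>2 \<omega> = (sigma_min (M_mat h w lam\<^sub>1 lam\<^sub>2 \<omega>))\<^sup>2"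

end

(* The quadratic form of A = A(W1, W2) dominates u |-> |M u|^2, because W1, W2 >= omega_min I, and
   |M u|^2 >= alpha |u|^2 by the Rayleigh quotient characterization of the smallest eigenvalue of
   M^T M. M is injective since R u = 0 leaves only the first block of u, on which S is the identity;
   hence alpha > 0 and A is invertible. Testing A d = S^T (f1 - f2), for the difference d of the two
   fixed points, against d gives alpha |d|^2 <= <S d, f1 - f2> <= |S| |d| |f1 - f2|. *)

theory Submission
  imports Defs "Jordan_Normal_Form.Spectral_Radius"
begin

section \<open>Euclidean norm and the Cauchy-Schwarz inequality for semidefinite forms\<close>

lemma scalar_prod_self_nonneg: "0 \<le> v \<bullet> (v :: real vec)"
  unfolding scalar_prod_def by (intro sum_nonneg) auto

lemma scalar_prod_self_eq_0_iff:
  assumes "v \<in> carrier_vec n"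
  shows "v \<bullet> v = 0 \<longleftrightarrow> v = (0\<^sub>v n :: real vec)"
  using conjugate_square_eq_0_vec[OF assms] by simp

lemma scalar_prod_self_pos:
  assumes "v \<in> carrier_vec n" "v \<noteq> (0\<^sub>v n :: real vec)"
  shows "0 < v \<bullet> v"
  using scalar_prod_self_nonneg[of v] scalar_prod_self_eq_0_iff[OF assms(1)] assms(2) by simp

lemma l2norm_vec_nonneg: "0 \<le> l2norm_vec v"
  by (simp add: l2norm_vec_def scalar_prod_self_nonneg)

lemma l2norm_vec_sq: "(l2norm_vec v)\<^sup>2 = v \<bullet> v"
  by (simp add: l2norm_vec_def scalar_prod_self_nonneg)

lemma l2norm_vec_smult: "l2norm_vec (c \<cdot>\<^sub>v v) = \<bar>c\<bar> * l2norm_vec v"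
  by (simp add: l2norm_vec_def real_sqrt_mult flip: mult.assoc power2_eq_square)

text \<open>The form is nonnegative along the line x + t y, and a real quadratic in t that never
  becomes negative obeys the discriminant inequality. As \<open>B\<close> may be singular, the
  leading coefficient can vanish and gets its own case.\<close>

lemma pos_semidef_Cauchy_Schwarz:
  assumes psd: "pos_semidef B" and B: "B \<in> carrier_mat n n"
    and x: "x \<in> carrier_vec n" and y: "y \<in> carrier_vec n"
  shows "(x \<bullet> (B *\<^sub>v y))\<^sup>2 \<le> (x \<bullet> (B *\<^sub>v x)) * (y \<bullet> (B *\<^sub>v y))"
proof -
  define a where "a = x \<bullet> (B *\<^sub>v x)"
  define b where "b = x \<bullet> (B *\<^sub>v y)"
  define c where "c = y \<bullet> (B *\<^sub>v y)"
  have Bx: "B *\<^sub>v x \<in> carrier_vec n" and By: "B *\<^sub>v y \<in> carrier_vec n" using B x y by auto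
  \<comment> \<open>Symmetry of \<open>B\<close> merges the two cross terms of the expanded form
    into \<open>2 * t * b\<close>.\<close>
  have sym: "y \<bullet> (B *\<^sub>v x) = b"
  proof -
    have "y \<bullet> (B *\<^sub>v x) = (transpose_mat B *\<^sub>v y) \<bullet> x"
      using transpose_vec_mult_scalar[OF B x y] by simp
    also have "\<dots> = b"
      using psd comm_scalar_prod[OF By x] by (simp add: pos_semidef_def b_def)
    finally show ?thesis .
  qed
  have quad: "0 \<le> a + 2 * t * b + t\<^sup>2 * c" for t
  proof -
    have ty: "t \<cdot>\<^sub>v y \<in> carrier_vec n" using y by simp
    have tBy: "t \<cdot>\<^sub>v (B *\<^sub>v y) \<in> carrier_vec n" using By by simp
    have "0 \<le> (x + t \<cdot>\<^sub>v y) \<bullet> (B *\<^sub>v (x + t \<cdot>\<^sub>v y))"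
      using psd B x ty by (simp add: pos_semidef_def)
    also have "B *\<^sub>v (x + t \<cdot>\<^sub>v y) = B *\<^sub>v x + t \<cdot>\<^sub>v (B *\<^sub>v y)"
      using mult_add_distrib_mat_vec[OF B x ty] mult_mat_vec[OF B y] by simp
    also have "(x + t \<cdot>\<^sub>v y) \<bullet> \<dots> = a + 2 * t * b + t\<^sup>2 * c"
      using x y Bx By ty tBy B sym
      by (simp add: add_scalar_prod_distrib[of _ n] scalar_prod_add_distrib[of _ n] a_def b_def c_def
          power2_eq_square algebra_simps)
    finally show ?thesis .
  qed
  have c: "0 \<le> c" using psd B y by (simp add: pos_semidef_def c_def)
  have "b\<^sup>2 \<le> a * c"
  proof (cases "c = 0")
    case True
    have "b = 0"
    proof (rule ccontr)
      assume "b \<noteq> 0"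
      \<comment> \<open>Without the quadratic term the polynomial is affine in t, and this t gives
        it the value -1.\<close>
      then show False using quad[of "- (a + 1) / (2 * b)"] True by (simp add: field_simps)
    qed
    then show ?thesis using True by simp
  next
    case False
    with c have "0 < c" by simp
    \<comment> \<open>This t minimizes the quadratic; the minimum is
      \<open>a - b\<^sup>2 / c\<close>.\<close>
    with quad[of "- b / c"] show ?thesis by (simp add: field_simps power2_eq_square)
  qed
  then show ?thesis by (simp add: a_def b_def c_def)
qed

lemma pos_semidef_one: "pos_semidef (1\<^sub>m n)"
  by (auto simp: pos_semidef_def scalar_prod_self_nonneg)

lemma scalar_prod_Cauchy_Schwarz:
  assumes "x \<in> carrier_vec n" "y \<in> carrier_vec n"
  shows "(x \<bullet> y)\<^sup>2 \<le> (x \<bullet> x) * (y \<bullet> (y :: real vec))"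
  using pos_semidef_Cauchy_Schwarz[OF pos_semidef_one one_carrier_mat assms] assms by simp

lemma abs_scalar_prod_le:
  assumes "x \<in> carrier_vec n" "y \<in> carrier_vec n"
  shows "\<bar>x \<bullet> y\<bar> \<le> l2norm_vec x * l2norm_vec y"
  using real_sqrt_le_mono[OF scalar_prod_Cauchy_Schwarz[OF assms]]
  by (simp add: l2norm_vec_def real_sqrt_mult)

section \<open>Boundedness, inverses and coercivity of matrices\<close>

text \<open>A crude Frobenius bound, from Cauchy-Schwarz in each row. It ensures that the spectral
  norm and the infimum of the Rayleigh quotient are taken over bounded sets.\<close>

lemma mult_mat_vec_bounded:
  assumes "A \<in> carrier_mat nr nc"
  obtains K where "0 < K" "\<And>x. x \<in> carrier_vec nc \<Longrightarrow> l2norm_vec (A *\<^sub>v x) \<le> K * l2norm_vec x"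
proof -
  define c where "c = (\<Sum>i\<in>{0..<nr}. row A i \<bullet> row A i)"
  have c: "0 \<le> c" unfolding c_def by (intro sum_nonneg scalar_prod_self_nonneg)
  \<comment> \<open>Adding 1 to the squared Frobenius norm \<open>c\<close> keeps the factor
    positive even for the zero matrix.\<close>
  have "l2norm_vec (A *\<^sub>v x) \<le> sqrt (c + 1) * l2norm_vec x" if x: "x \<in> carrier_vec nc" for x
  proof -
    have "(A *\<^sub>v x) \<bullet> (A *\<^sub>v x) = (\<Sum>i\<in>{0..<nr}. (row A i \<bullet> x)\<^sup>2)"
      using assms by (auto simp: scalar_prod_def[of "A *\<^sub>v x"] power2_eq_square)
    also have "\<dots> \<le> (\<Sum>i\<in>{0..<nr}. (row A i \<bullet> row A i) * (x \<bullet> x))"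
      using assms x by (intro sum_mono scalar_prod_Cauchy_Schwarz[of _ nc]) auto
    also have "\<dots> \<le> (c + 1) * (x \<bullet> x)"
      by (simp add: c_def distrib_right scalar_prod_self_nonneg flip: sum_distrib_right)
    finally show ?thesis
      by (simp add: l2norm_vec_def flip: real_sqrt_mult)
  qed
  moreover have "0 < sqrt (c + 1)" using c by simp
  ultimately show thesis using that by blast
qed

lemma invertible_imp_inverse:
  fixes A :: "'a :: field mat"
  assumes "A \<in> carrier_mat n n" "det A \<noteq> 0"
  obtains B where "mat_inverse A = Some B" "B \<in> carrier_mat n n" "A * B = 1\<^sub>m n" "B * A = 1\<^sub>m n"
proof (cases "mat_inverse A")
  case None
  \<comment> \<open>\<open>None\<close> would say that \<open>A\<close> is not a unit of the matrix
    ring, which its nonzero determinant contradicts; \<open>()\<close> picks the same ring instance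
    in both facts.\<close>
  with mat_inverse(1)[OF assms(1) None, of "()"] det_non_zero_imp_unit[OF assms, of "()"]
  show thesis by blast
next
  case (Some B)
  with mat_inverse(2)[OF assms(1) Some] that show thesis by blast
qed

text \<open>With \<open>y = B x\<close>, Cauchy--Schwarz for the form of \<open>B\<close> gives
  \<open>\<parallel>y\<parallel>\<^sup>4 \<le> (y \<bullet> B y) (x \<bullet> B x) \<le> K \<parallel>y\<parallel>\<^sup>2 (x \<bullet> B x)\<close>, and \<open>\<parallel>x\<parallel> \<le> L \<parallel>y\<parallel>\<close>
  since \<open>B\<close> has an inverse.\<close>

lemma pos_semidef_coercive:
  assumes psd: "pos_semidef B" and B: "B \<in> carrier_mat n n" and det: "det B \<noteq> 0"
  obtains c where "0 < c" "\<And>x. x \<in> carrier_vec n \<Longrightarrow> c * (x \<bullet> x) \<le> x \<bullet> (B *\<^sub>v x)"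
proof -
  obtain C where C: "C \<in> carrier_mat n n" and CB: "C * B = 1\<^sub>m n"
    using invertible_imp_inverse[OF B det] by metis
  obtain K where K: "0 < K" "\<And>x. x \<in> carrier_vec n \<Longrightarrow> l2norm_vec (B *\<^sub>v x) \<le> K * l2norm_vec x"
    using mult_mat_vec_bounded[OF B] by metis
  obtain L where L: "0 < L" "\<And>x. x \<in> carrier_vec n \<Longrightarrow> l2norm_vec (C *\<^sub>v x) \<le> L * l2norm_vec x"
    using mult_mat_vec_bounded[OF C] by metis
  \<comment> \<open>The constant comes from |x|^2 \<le> L^2 |y|^2 \<le> L^2 K q, where y = B x and q
    is the form at x.\<close>
  have "1 / (L\<^sup>2 * K) * (x \<bullet> x) \<le> x \<bullet> (B *\<^sub>v x)" if x: "x \<in> carrier_vec n" for x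
  proof -
    define q where "q = x \<bullet> (B *\<^sub>v x)"
    define y where "y = B *\<^sub>v x"
    have y: "y \<in> carrier_vec n" and By: "B *\<^sub>v y \<in> carrier_vec n" using B x by (auto simp: y_def)
    have q: "0 \<le> q" using psd B x by (simp add: pos_semidef_def q_def)
    have Bform: "y \<bullet> (B *\<^sub>v y) \<le> K * (y \<bullet> y)"
    proof -
      have "y \<bullet> (B *\<^sub>v y) \<le> l2norm_vec y * l2norm_vec (B *\<^sub>v y)"
        using abs_scalar_prod_le[OF y By] by simp
      also have "\<dots> \<le> l2norm_vec y * (K * l2norm_vec y)"
        using K(2)[OF y] by (intro mult_left_mono l2norm_vec_nonneg)
      also have "\<dots> = K * (y \<bullet> y)"
        by (simp add: power2_eq_square flip: l2norm_vec_sq)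
      finally show ?thesis .
    qed
    have "(y \<bullet> y)\<^sup>2 \<le> (y \<bullet> (B *\<^sub>v y)) * q"
      using pos_semidef_Cauchy_Schwarz[OF psd B y x] by (simp add: q_def y_def)
    also have "\<dots> \<le> (K * (y \<bullet> y)) * q"
      using Bform q by (rule mult_right_mono)
    finally have "(y \<bullet> y) * (y \<bullet> y) \<le> (y \<bullet> y) * (K * q)"
      by (simp add: power2_eq_square algebra_simps)
    \<comment> \<open>One factor |y|^2 cancels; for y = 0 the claim is 0 \<le> K q.\<close>
    then have yy: "y \<bullet> y \<le> K * q"
      using scalar_prod_self_nonneg[of y] q K(1) by (cases "y \<bullet> y = 0") auto
    have "x = C *\<^sub>v y"
      unfolding y_def using assoc_mult_mat_vec[OF C B x] CB x by simp
    then have "(l2norm_vec x)\<^sup>2 \<le> (L * l2norm_vec y)\<^sup>2"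
      using L(2)[OF y] by (intro power_mono l2norm_vec_nonneg) simp
    also have "\<dots> \<le> L\<^sup>2 * (K * q)"
      using yy by (simp add: power_mult_distrib l2norm_vec_sq mult_left_mono)
    finally have "x \<bullet> x \<le> L\<^sup>2 * K * q"
      by (simp add: l2norm_vec_sq)
    then show ?thesis
      using K(1) L(1) by (simp add: q_def field_simps)
  qed
  moreover have "0 < 1 / (L\<^sup>2 * K)" using K(1) L(1) by simp
  ultimately show thesis using that by blast
qed

section \<open>Smallest eigenvalue of a symmetric matrix\<close>

lemma smult_mat_mult_vec:
  fixes A :: "'a :: comm_ring_1 mat"
  assumes "A \<in> carrier_mat nr nc" "x \<in> carrier_vec nc"
  shows "(c \<cdot>\<^sub>m A) *\<^sub>v x = c \<cdot>\<^sub>v (A *\<^sub>v x)"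
  using assms by (auto intro!: eq_vecI)

text \<open>The infimum \<open>m\<close> of the Rayleigh quotient is an eigenvalue: otherwise the positive semidefinite
  matrix \<open>A - m I\<close> would be coercive, so that the quotient would stay away from \<open>m\<close>.\<close>

lemma symmetric_min_eigenvalue:
  fixes A :: "real mat"
  assumes A: "A \<in> carrier_mat n n" and sym: "transpose_mat A = A" and n: "0 < n"
  obtains m where "eigenvalue A m" "\<And>x. x \<in> carrier_vec n \<Longrightarrow> m * (x \<bullet> x) \<le> x \<bullet> (A *\<^sub>v x)"
proof -
  define R where "R = {x \<bullet> (A *\<^sub>v x) | x. x \<in> carrier_vec n \<and> x \<bullet> x = 1}"
  define m where "m = Inf R"
  obtain K where K: "\<And>x. x \<in> carrier_vec n \<Longrightarrow> l2norm_vec (A *\<^sub>v x) \<le> K * l2norm_vec x"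
    using mult_mat_vec_bounded[OF A] by metis
  \<comment> \<open>On the unit sphere |x . A x| is at most |A x| \<le> K. A real \<open>Inf\<close>
    is meaningful only for a nonempty set that is bounded below.\<close>
  have "- K \<le> r" if r: "r \<in> R" for r
  proof -
    obtain x where x: "x \<in> carrier_vec n" "x \<bullet> x = 1" "r = x \<bullet> (A *\<^sub>v x)"
      using r by (auto simp: R_def)
    show ?thesis
      using abs_scalar_prod_le[OF x(1), of "A *\<^sub>v x"] K[OF x(1)] A x by (simp add: l2norm_vec_def)
  qed
  then have bdd: "bdd_below R" by (rule bdd_belowI)
  have ne: "R \<noteq> {}"
  proof -
    have "unit_vec n 0 \<bullet> unit_vec n 0 = (1 :: real)" using n by simp
    then have "unit_vec n 0 \<bullet> (A *\<^sub>v unit_vec n 0) \<in> R"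
      unfolding R_def using unit_vec_carrier by blast
    then show ?thesis by blast
  qed
  have low: "m * (x \<bullet> x) \<le> x \<bullet> (A *\<^sub>v x)" if x: "x \<in> carrier_vec n" for x
  proof (cases "x = 0\<^sub>v n")
    case True
    then show ?thesis using A by simp
  next
    case False
    define s where "s = x \<bullet> x"
    have s: "0 < s" using scalar_prod_self_pos[OF x False] by (simp add: s_def)
    \<comment> \<open>Rescaling to the unit sphere divides the form by x . x, so the bound by the
      infimum carries over to every nonzero x.\<close>
    define u where "u = (1 / sqrt s) \<cdot>\<^sub>v x"
    have u: "u \<in> carrier_vec n" using x by (simp add: u_def)
    have uu: "u \<bullet> u = 1" using x s by (simp add: u_def s_def[symmetric])
    have "u \<bullet> (A *\<^sub>v u) = (x \<bullet> (A *\<^sub>v x)) / s"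
      using x s A by (simp add: u_def mult_mat_vec[OF A x])
    moreover have "m \<le> u \<bullet> (A *\<^sub>v u)"
      unfolding m_def using u uu by (intro cInf_lower bdd) (auto simp: R_def)
    ultimately show ?thesis using s by (simp add: pos_le_divide_eq flip: s_def)
  qed
  \<comment> \<open>\<open>char_matrix A m\<close> is A - m I: it is singular exactly when
    \<open>m\<close> is an eigenvalue, and \<open>low\<close> says that its form is
    nonnegative.\<close>
  let ?B = "char_matrix A m"
  have B: "?B \<in> carrier_mat n n" using A by simp
  have form: "x \<bullet> (?B *\<^sub>v x) = x \<bullet> (A *\<^sub>v x) - m * (x \<bullet> x)" if x: "x \<in> carrier_vec n" for x
  proof -
    have "?B *\<^sub>v x = A *\<^sub>v x + (- m) \<cdot>\<^sub>v x"
      using A x by (simp add: char_matrix_def add_mult_distrib_mat_vec[of _ n n]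
          smult_mat_mult_vec[of _ n n])
    then show ?thesis using A x by (simp add: scalar_prod_add_distrib[of _ n])
  qed
  have "transpose_mat ((- m) \<cdot>\<^sub>m 1\<^sub>m n) = (- m) \<cdot>\<^sub>m 1\<^sub>m n"
    by (rule eq_matI) auto
  then have symB: "transpose_mat ?B = ?B"
    using A sym by (simp add: char_matrix_def transpose_add[of _ n n])
  have psd: "pos_semidef ?B"
    unfolding pos_semidef_def using B symB low form by auto
  have "det ?B = 0"
  proof (rule ccontr)
    assume "det ?B \<noteq> 0"
    from pos_semidef_coercive[OF psd B this] obtain c where
      c: "0 < c" "\<And>x. x \<in> carrier_vec n \<Longrightarrow> c * (x \<bullet> x) \<le> x \<bullet> (?B *\<^sub>v x)"
      by metis
    have "m + c \<le> Inf R"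
    proof (rule cInf_greatest[OF ne])
      fix r assume "r \<in> R"
      then show "m + c \<le> r" using c(2) form by (fastforce simp: R_def)
    qed
    with c(1) show False by (simp add: m_def)
  qed
  then have "eigenvalue A m" by (simp add: eigenvalue_det[OF A])
  with low that show thesis by blast
qed

section \<open>Smallest singular value\<close>

lemma scalar_prod_transpose_mult_self:
  fixes M :: "real mat"
  assumes M: "M \<in> carrier_mat nr nc" and x: "x \<in> carrier_vec nc"
  shows "x \<bullet> ((transpose_mat M * M) *\<^sub>v x) = (M *\<^sub>v x) \<bullet> (M *\<^sub>v x)"
proof -
  have Mx: "M *\<^sub>v x \<in> carrier_vec nr" using M x by simp
  have "x \<bullet> ((transpose_mat M * M) *\<^sub>v x) = (transpose_mat M *\<^sub>v (M *\<^sub>v x)) \<bullet> x"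
    using M x Mx by (simp add: assoc_mult_mat_vec[of _ nc nr] comm_scalar_prod[of _ nc])
  then show ?thesis
    by (simp add: transpose_vec_mult_scalar[OF M x Mx])
qed

text \<open>Injectivity makes every eigenvalue of the Gram matrix M^T M positive. The Rayleigh bound
  \<open>m\<close> is one of these eigenvalues, so the square of the smallest singular value is at
  most \<open>m\<close> and inherits its bound.\<close>

lemma sigma_min_injective:
  fixes M :: "real mat"
  assumes M: "M \<in> carrier_mat nr nc" and nc: "0 < nc"
    and inj: "\<And>x. x \<in> carrier_vec nc \<Longrightarrow> M *\<^sub>v x = 0\<^sub>v nr \<Longrightarrow> x = 0\<^sub>v nc"
  shows "0 < sigma_min M"
    and "x \<in> carrier_vec nc \<Longrightarrow> (sigma_min M)\<^sup>2 * (x \<bullet> x) \<le> (M *\<^sub>v x) \<bullet> (M *\<^sub>v x)"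
proof -
  let ?Q = "transpose_mat M * M"
  have Q: "?Q \<in> carrier_mat nc nc" using M by simp
  have symQ: "transpose_mat ?Q = ?Q" using M by (simp add: transpose_mult[of _ nc nr])
  obtain m where m: "eigenvalue ?Q m" "\<And>x. x \<in> carrier_vec nc \<Longrightarrow> m * (x \<bullet> x) \<le> x \<bullet> (?Q *\<^sub>v x)"
    using symmetric_min_eigenvalue[OF Q symQ nc] by metis
  have pos: "0 < \<mu>" if ev: "eigenvalue ?Q \<mu>" for \<mu>
  proof -
    obtain v where v: "v \<in> carrier_vec nc" "v \<noteq> 0\<^sub>v nc" "?Q *\<^sub>v v = \<mu> \<cdot>\<^sub>v v"
      using ev M by (auto simp: eigenvalue_def eigenvector_def)
    have "\<mu> * (v \<bullet> v) = (M *\<^sub>v v) \<bullet> (M *\<^sub>v v)"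
      using scalar_prod_transpose_mult_self[OF M v(1)] v by simp
    also have "\<dots> > 0"
      using inj[OF v(1)] v M by (intro scalar_prod_self_pos[of _ nr]) auto
    finally show ?thesis
      using scalar_prod_self_nonneg[of v] by (simp add: zero_less_mult_iff)
  qed
  have sv: "singular_values M = sqrt ` spectrum ?Q"
    by (auto simp: singular_values_def spectrum_def)
  \<comment> \<open>\<open>Min\<close> yields a minimum only on a finite nonempty set: the spectrum
    is finite, and \<open>sqrt m\<close> will be a member.\<close>
  have fin: "finite (singular_values M)"
    unfolding sv using card_finite_spectrum(1)[OF Q] by simp
  have mem: "sqrt m \<in> singular_values M" using m(1) by (auto simp: singular_values_def)
  have "sigma_min M \<in> singular_values M"
    unfolding sigma_min_def using fin mem by (intro Min_in) auto
  then show gt0: "0 < sigma_min M" using pos by (auto simp: singular_values_def)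
  have "sigma_min M \<le> sqrt m" unfolding sigma_min_def using fin mem by simp
  then have "(sigma_min M)\<^sup>2 \<le> (sqrt m)\<^sup>2"
    using gt0 by (intro power_mono) auto
  then have le: "(sigma_min M)\<^sup>2 \<le> m" using pos[OF m(1)] by simp
  assume x: "x \<in> carrier_vec nc"
  have "(sigma_min M)\<^sup>2 * (x \<bullet> x) \<le> m * (x \<bullet> x)"
    using le by (intro mult_right_mono scalar_prod_self_nonneg)
  also have "\<dots> \<le> (M *\<^sub>v x) \<bullet> (M *\<^sub>v x)"
    using m(2)[OF x] scalar_prod_transpose_mult_self[OF M x] by simp
  finally show "(sigma_min M)\<^sup>2 * (x \<bullet> x) \<le> (M *\<^sub>v x) \<bullet> (M *\<^sub>v x)" .
qed

section \<open>The spectral norm as an operator bound\<close>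

text \<open>A real \<open>SUP\<close> is known to bound its members only if the set is bounded
  above, which the Frobenius bound ensures.\<close>

lemma spectral_norm_upper:
  assumes A: "A \<in> carrier_mat nr nc" and x: "x \<in> carrier_vec nc" "l2norm_vec x \<le> 1"
  shows "l2norm_vec (A *\<^sub>v x) \<le> spectral_norm A"
proof -
  obtain K where K: "0 < K" "\<And>x. x \<in> carrier_vec nc \<Longrightarrow> l2norm_vec (A *\<^sub>v x) \<le> K * l2norm_vec x"
    using mult_mat_vec_bounded[OF A] by metis
  have "l2norm_vec (A *\<^sub>v z) \<le> K" if z: "z \<in> carrier_vec nc" "l2norm_vec z \<le> 1" for z
    using K(2)[OF z(1)] mult_left_mono[OF z(2), of K] K(1) by linarith
  then have "bdd_above ((\<lambda>x. l2norm_vec (A *\<^sub>v x)) ` {x \<in> carrier_vec (dim_col A). l2norm_vec x \<le> 1})"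
    using A by (intro bdd_aboveI2[where M = K]) auto
  then show ?thesis
    unfolding spectral_norm_def using x A by (intro cSUP_upper) auto
qed

lemma spectral_norm_nonneg: "0 \<le> spectral_norm A"
proof -
  have "l2norm_vec (A *\<^sub>v 0\<^sub>v (dim_col A)) \<le> spectral_norm A"
    by (rule spectral_norm_upper[of _ "dim_row A" "dim_col A"]) (auto simp: l2norm_vec_def)
  then show ?thesis using l2norm_vec_nonneg order_trans by blast
qed

lemma l2norm_mult_mat_vec_le:
  assumes A: "A \<in> carrier_mat nr nc" and x: "x \<in> carrier_vec nc"
  shows "l2norm_vec (A *\<^sub>v x) \<le> spectral_norm A * l2norm_vec x"
proof (cases "x = 0\<^sub>v nc")
  case True
  then have "A *\<^sub>v x = 0\<^sub>v nr" using A by auto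
  with True show ?thesis by (simp add: l2norm_vec_def)
next
  case False
  define s where "s = l2norm_vec x"
  have s: "0 < s" using scalar_prod_self_pos[OF x False] by (simp add: s_def l2norm_vec_def)
  \<comment> \<open>The unit ball bound is applied to x scaled to norm 1; homogeneity then restores
    the factor.\<close>
  have "l2norm_vec (A *\<^sub>v ((1 / s) \<cdot>\<^sub>v x)) \<le> spectral_norm A"
    using x s by (intro spectral_norm_upper[OF A]) (simp_all add: l2norm_vec_smult s_def[symmetric])
  then show ?thesis
    using s by (simp add: mult_mat_vec[OF A x] l2norm_vec_smult s_def[symmetric] field_simps)
qed

section \<open>Coercive linear systems and weighted quadratic forms\<close>

text \<open>An energy estimate: the equation is tested with \<open>d\<close>, the transpose moves
  \<open>S\<close> onto \<open>d\<close>, Cauchy-Schwarz and the spectral norm bound the result, and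
  one factor |d| cancels.\<close>

lemma coercive_normal_equations_bound:
  assumes A: "A \<in> carrier_mat n n" and S: "S \<in> carrier_mat m n"
    and d: "d \<in> carrier_vec n" and g: "g \<in> carrier_vec m"
    and a: "0 < a" and coercive: "a * (d \<bullet> d) \<le> d \<bullet> (A *\<^sub>v d)"
    and eq: "A *\<^sub>v d = transpose_mat S *\<^sub>v g"
  shows "l2norm_vec d \<le> spectral_norm S / a * l2norm_vec g"
proof -
  have Stg: "transpose_mat S *\<^sub>v g \<in> carrier_vec n" and Sd: "S *\<^sub>v d \<in> carrier_vec m"
    using S d g by auto
  have "a * l2norm_vec d * l2norm_vec d \<le> d \<bullet> (transpose_mat S *\<^sub>v g)"
    using coercive eq by (simp add: power2_eq_square mult.assoc flip: l2norm_vec_sq)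
  also have "\<dots> = g \<bullet> (S *\<^sub>v d)"
    using transpose_vec_mult_scalar[OF S d g] comm_scalar_prod[OF d Stg] by simp
  also have "\<dots> \<le> l2norm_vec g * l2norm_vec (S *\<^sub>v d)"
    using abs_scalar_prod_le[OF g Sd] by simp
  also have "\<dots> \<le> l2norm_vec g * (spectral_norm S * l2norm_vec d)"
    by (intro mult_left_mono l2norm_mult_mat_vec_le[OF S d] l2norm_vec_nonneg)
  finally have le: "a * l2norm_vec d * l2norm_vec d \<le> spectral_norm S * l2norm_vec g * l2norm_vec d"
    by (simp add: algebra_simps)
  have "a * l2norm_vec d \<le> spectral_norm S * l2norm_vec g"
  \<comment> \<open>For |d| = 0 nothing can be cancelled, but the left side is 0 and the right side
    is nonnegative.\<close>
  proof (cases "l2norm_vec d = 0")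
    case True
    then show ?thesis by (simp add: spectral_norm_nonneg l2norm_vec_nonneg)
  next
    case False
    with l2norm_vec_nonneg[of d] have "0 < l2norm_vec d" by simp
    with le show ?thesis by simp
  qed
  with a show ?thesis by (simp add: field_simps)
qed

text \<open>A nonzero kernel vector would give the form the value 0, against coercivity.\<close>

lemma coercive_imp_invertible:
  fixes A :: "real mat"
  assumes A: "A \<in> carrier_mat n n" and a: "0 < a"
    and coercive: "\<And>x. x \<in> carrier_vec n \<Longrightarrow> a * (x \<bullet> x) \<le> x \<bullet> (A *\<^sub>v x)"
  shows "det A \<noteq> 0"
proof
  assume "det A = 0"
  then obtain v where v: "v \<in> carrier_vec n" "v \<noteq> 0\<^sub>v n" "A *\<^sub>v v = 0\<^sub>v n"
    using det_0_iff_vec_prod_zero[OF A] by blast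
  have "a * (v \<bullet> v) \<le> 0" using coercive[OF v(1)] v(1,3) by simp
  with a scalar_prod_self_pos[OF v(1,2)] show False by (simp add: mult_le_0_iff)
qed

lemma scalar_prod_transpose_mult_mult:
  fixes G W :: "real mat"
  assumes G: "G \<in> carrier_mat m n" and W: "W \<in> carrier_mat m m" and x: "x \<in> carrier_vec n"
  shows "x \<bullet> ((transpose_mat G * W * G) *\<^sub>v x) = (G *\<^sub>v x) \<bullet> (W *\<^sub>v (G *\<^sub>v x))"
proof -
  have Gx: "G *\<^sub>v x \<in> carrier_vec m" using G x by simp
  have WGx: "W *\<^sub>v (G *\<^sub>v x) \<in> carrier_vec m" using W Gx by simp
  have Gt: "transpose_mat G \<in> carrier_mat n m" using G by simp
  have "(transpose_mat G * W * G) *\<^sub>v x = transpose_mat G *\<^sub>v (W *\<^sub>v (G *\<^sub>v x))"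
    using assoc_mult_mat_vec[OF mult_carrier_mat[OF Gt W] G x] assoc_mult_mat_vec[OF Gt W Gx] by simp
  then have "x \<bullet> ((transpose_mat G * W * G) *\<^sub>v x) = (transpose_mat G *\<^sub>v (W *\<^sub>v (G *\<^sub>v x))) \<bullet> x"
    using x Gt WGx by (simp add: comm_scalar_prod[of _ n])
  then show ?thesis
    using transpose_vec_mult_scalar[OF G x WGx] comm_scalar_prod[OF Gx WGx] by simp
qed

text \<open>Passes from the matrix order to quadratic forms, to be applied to the weights at G x and
  R x.\<close>

lemma loewner_le_smult_one_form:
  assumes "c \<cdot>\<^sub>m 1\<^sub>m n \<preceq>\<^sub>L W" and W: "W \<in> carrier_mat n n" and y: "y \<in> carrier_vec n"
  shows "c * (y \<bullet> y) \<le> y \<bullet> (W *\<^sub>v y)"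
proof -
  have "0 \<le> y \<bullet> ((W - c \<cdot>\<^sub>m 1\<^sub>m n) *\<^sub>v y)"
    using assms by (auto simp: loewner_le_def pos_semidef_def)
  also have "(W - c \<cdot>\<^sub>m 1\<^sub>m n) *\<^sub>v y = W *\<^sub>v y - c \<cdot>\<^sub>v y"
    using W y by (simp add: minus_mult_distrib_mat_vec[of _ n n] smult_mat_mult_vec[of _ n n])
  also have "y \<bullet> \<dots> = y \<bullet> (W *\<^sub>v y) - c * (y \<bullet> y)"
    using W y by (simp add: scalar_prod_minus_distrib[of _ n])
  finally show ?thesis by simp
qed

section \<open>Block matrices acting on vectors\<close>

lemma zero_mult_vec:
  assumes "x \<in> carrier_vec n"
  shows "0\<^sub>m m n *\<^sub>v x = (0\<^sub>v m :: 'a :: semiring_1 vec)"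
  using assms by (auto intro!: eq_vecI)

lemma append_cols_carrier:
  assumes "A \<in> carrier_mat m n1" "B \<in> carrier_mat m n2"
  shows "A @\<^sub>c B \<in> carrier_mat m (n1 + n2)"
  using assms by (auto simp: append_cols_def)

lemma append_cols_mult_vec:
  assumes A: "A \<in> carrier_mat m n1" and B: "B \<in> carrier_mat m n2"
    and a: "a \<in> carrier_vec n1" and b: "b \<in> carrier_vec n2"
  shows "(A @\<^sub>c B) *\<^sub>v (a @\<^sub>v b) = A *\<^sub>v a + B *\<^sub>v b"
proof -
  \<comment> \<open>The lower blocks in \<open>append_cols\<close> have no rows, so the four-block
    product carries a trailing vector of dimension 0.\<close>
  have "(A @\<^sub>c B) *\<^sub>v (a @\<^sub>v b) =
      (A *\<^sub>v a + B *\<^sub>v b) @\<^sub>v (0\<^sub>m 0 n1 *\<^sub>v a + 0\<^sub>m 0 n2 *\<^sub>v b)"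
    unfolding append_cols_def using A B a b
    by (subst four_block_mat_mult_vec[of _ m n1 _ n2 _ 0]) auto
  also have "\<dots> = A *\<^sub>v a + B *\<^sub>v b"
    using A B by (intro eq_vecI) auto
  finally show ?thesis .
qed

lemma append_rows_mult_vec_sq:
  fixes A B :: "real mat"
  assumes A: "A \<in> carrier_mat m1 n" and B: "B \<in> carrier_mat m2 n" and x: "x \<in> carrier_vec n"
  shows "((A @\<^sub>r B) *\<^sub>v x) \<bullet> ((A @\<^sub>r B) *\<^sub>v x) =
    (A *\<^sub>v x) \<bullet> (A *\<^sub>v x) + (B *\<^sub>v x) \<bullet> (B *\<^sub>v x)"
  using A B x by (simp add: mat_mult_append[OF A B x] scalar_prod_append[of _ m1 _ m2])

section \<open>Dimensions and quadratic forms of the model matrices\<close>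

lemma diff_mat_carrier: "diff_mat m \<in> carrier_mat m m"
  by (simp add: diff_mat_def)

lemma kronecker_carrier:
  assumes "A \<in> carrier_mat m1 n1" "B \<in> carrier_mat m2 n2"
  shows "A \<otimes>\<^sub>K B \<in> carrier_mat (m1 * m2) (n1 * n2)"
  using assms by (simp add: kronecker_def)

lemma grad_carrier: "grad h w \<in> carrier_mat (2 * (h * w)) (h * w)"
  using carrier_append_rows[OF kronecker_carrier[OF one_carrier_mat[of h] diff_mat_carrier[of w]]
      kronecker_carrier[OF diff_mat_carrier[of h] one_carrier_mat[of w]]]
  by (simp add: grad_def grad_x_def grad_y_def mult_2)

lemma S_mat_carrier: "S_mat h w \<in> carrier_mat (h * w) (3 * (h * w))"
  using append_cols_carrier[OF one_carrier_mat[of "h * w"],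
      of "- transpose_mat (grad h w)" "2 * (h * w)"] grad_carrier[of h w]
  by (simp add: S_mat_def)

lemma G_mat_carrier: "G_mat h w \<in> carrier_mat (2 * (h * w)) (3 * (h * w))"
  using append_cols_carrier[OF grad_carrier[of h w] zero_carrier_mat[of _ "2 * (h * w)"]]
  by (simp add: G_mat_def)

lemma R_mat_carrier: "R_mat h w \<in> carrier_mat (2 * (h * w)) (3 * (h * w))"
  using append_cols_carrier[OF zero_carrier_mat[of _ "h * w"] one_carrier_mat[of "2 * (h * w)"]]
  by (simp add: R_mat_def)

lemma M_mat_carrier: "M_mat h w lam\<^sub>1 lam\<^sub>2 \<omega> \<in> carrier_mat (5 * (h * w)) (3 * (h * w))"
  using carrier_append_rows[OF S_mat_carrier carrier_append_rows[OF
      smult_carrier_mat[OF G_mat_carrier] smult_carrier_mat[OF R_mat_carrier]]]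
  by (simp add: M_mat_def)

lemma A_mat_carrier:
  assumes "W\<^sub>1 \<in> carrier_mat (2 * (h * w)) (2 * (h * w))"
    and "W\<^sub>2 \<in> carrier_mat (2 * (h * w)) (2 * (h * w))"
  shows "A_mat h w lam\<^sub>1 lam\<^sub>2 W\<^sub>1 W\<^sub>2 \<in> carrier_mat (3 * (h * w)) (3 * (h * w))"
  unfolding A_mat_def
  using assms S_mat_carrier[of h w] G_mat_carrier[of h w] R_mat_carrier[of h w] by auto

text \<open>Squaring removes the roots in M, so |M x|^2 is the form of A with both weights replaced
  by \<omega> I.\<close>

lemma M_mat_sq:
  assumes x: "x \<in> carrier_vec (3 * (h * w))" and "0 \<le> lam\<^sub>1 * \<omega>" "0 \<le> lam\<^sub>2 * \<omega>"
  shows "(M_mat h w lam\<^sub>1 lam\<^sub>2 \<omega> *\<^sub>v x) \<bullet> (M_mat h w lam\<^sub>1 lam\<^sub>2 \<omega> *\<^sub>v x) =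
    (S_mat h w *\<^sub>v x) \<bullet> (S_mat h w *\<^sub>v x)
    + lam\<^sub>1 * \<omega> * ((G_mat h w *\<^sub>v x) \<bullet> (G_mat h w *\<^sub>v x))
    + lam\<^sub>2 * \<omega> * ((R_mat h w *\<^sub>v x) \<bullet> (R_mat h w *\<^sub>v x))"
proof -
  note G = G_mat_carrier[of h w] and R = R_mat_carrier[of h w]
  \<comment> \<open>\<open>sqrt\<close> is odd on the reals, so \<open>sqrt c * sqrt c\<close> is
    |c|; \<open>0 \<le> c\<close> turns this into c.\<close>
  have scaled: "((sqrt c \<cdot>\<^sub>m B) *\<^sub>v x) \<bullet> ((sqrt c \<cdot>\<^sub>m B) *\<^sub>v x) = c * ((B *\<^sub>v x) \<bullet> (B *\<^sub>v x))"
    if "0 \<le> c" "B \<in> carrier_mat m (3 * (h * w))" for c m and B :: "real mat"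
    using that x by (simp add: smult_mat_mult_vec[OF that(2) x] flip: mult.assoc)
  show ?thesis
    unfolding M_mat_def
    using append_rows_mult_vec_sq[OF S_mat_carrier[of h w] carrier_append_rows[OF
          smult_carrier_mat[OF G] smult_carrier_mat[OF R]] x]
      append_rows_mult_vec_sq[OF smult_carrier_mat[OF G] smult_carrier_mat[OF R] x]
      scaled[OF assms(2) G] scaled[OF assms(3) R]
    by simp
qed

text \<open>If \<open>R u = 0\<close> then \<open>u = (a, 0)\<close>, and then \<open>S u = a\<close>.\<close>

lemma M_mat_injective:
  assumes x: "x \<in> carrier_vec (3 * (h * w))" and "0 \<le> lam\<^sub>1 * \<omega>" "0 < lam\<^sub>2 * \<omega>"
    and Mx: "M_mat h w lam\<^sub>1 lam\<^sub>2 \<omega> *\<^sub>v x = 0\<^sub>v (5 * (h * w))"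
  shows "x = 0\<^sub>v (3 * (h * w))"
proof -
  let ?n = "h * w"
  have nonneg: "0 \<le> lam\<^sub>2 * \<omega>" using assms(3) by simp
  have Sx: "S_mat h w *\<^sub>v x \<in> carrier_vec ?n" and Rx: "R_mat h w *\<^sub>v x \<in> carrier_vec (2 * ?n)"
    using S_mat_carrier[of h w] R_mat_carrier[of h w] x by auto
  have "(S_mat h w *\<^sub>v x) \<bullet> (S_mat h w *\<^sub>v x)
    + lam\<^sub>1 * \<omega> * ((G_mat h w *\<^sub>v x) \<bullet> (G_mat h w *\<^sub>v x))
    + lam\<^sub>2 * \<omega> * ((R_mat h w *\<^sub>v x) \<bullet> (R_mat h w *\<^sub>v x)) = 0"
    using M_mat_sq[OF x assms(2) nonneg] Mx by simp
  moreover have "0 \<le> lam\<^sub>1 * \<omega> * ((G_mat h w *\<^sub>v x) \<bullet> (G_mat h w *\<^sub>v x))"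
    "0 \<le> lam\<^sub>2 * \<omega> * ((R_mat h w *\<^sub>v x) \<bullet> (R_mat h w *\<^sub>v x))"
    using assms(2) nonneg by (auto intro!: mult_nonneg_nonneg scalar_prod_self_nonneg)
  \<comment> \<open>Nonnegative terms with sum 0 all vanish. The factor of the R term is strictly
    positive and can be divided out next.\<close>
  ultimately have "(S_mat h w *\<^sub>v x) \<bullet> (S_mat h w *\<^sub>v x) = 0"
    "lam\<^sub>2 * \<omega> * ((R_mat h w *\<^sub>v x) \<bullet> (R_mat h w *\<^sub>v x)) = 0"
    using scalar_prod_self_nonneg[of "S_mat h w *\<^sub>v x"] by linarith+
  then have S0: "S_mat h w *\<^sub>v x = 0\<^sub>v ?n" and R0: "R_mat h w *\<^sub>v x = 0\<^sub>v (2 * ?n)"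
    using assms(3) scalar_prod_self_eq_0_iff[OF Sx] scalar_prod_self_eq_0_iff[OF Rx] by auto
  define a where "a = vec_first x ?n"
  define b where "b = vec_last x (2 * ?n)"
  have ab: "a \<in> carrier_vec ?n" "b \<in> carrier_vec (2 * ?n)" by (auto simp: a_def b_def)
  have xab: "x = a @\<^sub>v b"
    using vec_first_last_append[of x ?n "2 * ?n"] x by (simp add: a_def b_def)
  have "R_mat h w *\<^sub>v x = b"
    unfolding R_mat_def xab using ab by (simp add: append_cols_mult_vec[of _ "2 * ?n" ?n _ "2 * ?n"] zero_mult_vec)
  with R0 have b0: "b = 0\<^sub>v (2 * ?n)" by simp
  have gt: "- transpose_mat (grad h w) \<in> carrier_mat ?n (2 * ?n)" using grad_carrier[of h w] by simp
  have "S_mat h w *\<^sub>v x = a + (- transpose_mat (grad h w)) *\<^sub>v b"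
    unfolding S_mat_def xab using append_cols_mult_vec[OF one_carrier_mat gt ab] ab by simp
  also have "(- transpose_mat (grad h w)) *\<^sub>v b = 0\<^sub>v ?n"
    unfolding b0 using gt by auto
  finally have "a = 0\<^sub>v ?n" using S0 ab by simp
  with b0 xab show ?thesis by auto
qed

text \<open>The S terms of both sides agree; the other two are compared through the lower Loewner
  bounds on the weights.\<close>

lemma A_mat_form_ge_M_mat_sq:
  assumes x: "x \<in> carrier_vec (3 * (h * w))" and pos: "0 < lam\<^sub>1" "0 < lam\<^sub>2" "0 < \<omega>"
    and W1: "W\<^sub>1 \<in> carrier_mat (2 * (h * w)) (2 * (h * w))" "\<omega> \<cdot>\<^sub>m 1\<^sub>m (2 * (h * w)) \<preceq>\<^sub>L W\<^sub>1"
    and W2: "W\<^sub>2 \<in> carrier_mat (2 * (h * w)) (2 * (h * w))" "\<omega> \<cdot>\<^sub>m 1\<^sub>m (2 * (h * w)) \<preceq>\<^sub>L W\<^sub>2"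
  shows "(M_mat h w lam\<^sub>1 lam\<^sub>2 \<omega> *\<^sub>v x) \<bullet> (M_mat h w lam\<^sub>1 lam\<^sub>2 \<omega> *\<^sub>v x)
    \<le> x \<bullet> (A_mat h w lam\<^sub>1 lam\<^sub>2 W\<^sub>1 W\<^sub>2 *\<^sub>v x)"
proof -
  let ?N = "3 * (h * w)"
  let ?S = "S_mat h w" and ?G = "G_mat h w" and ?R = "R_mat h w"
  note S = S_mat_carrier[of h w] and G = G_mat_carrier[of h w] and R = R_mat_carrier[of h w]
  define P where "P = transpose_mat ?S * ?S"
  define Q1 where "Q1 = transpose_mat ?G * W\<^sub>1 * ?G"
  define Q2 where "Q2 = transpose_mat ?R * W\<^sub>2 * ?R"
  have carr: "P \<in> carrier_mat ?N ?N" "Q1 \<in> carrier_mat ?N ?N" "Q2 \<in> carrier_mat ?N ?N"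
    using S G R W1(1) W2(1) by (auto simp: P_def Q1_def Q2_def)
  have "A_mat h w lam\<^sub>1 lam\<^sub>2 W\<^sub>1 W\<^sub>2 *\<^sub>v x = P *\<^sub>v x + lam\<^sub>1 \<cdot>\<^sub>v (Q1 *\<^sub>v x) + lam\<^sub>2 \<cdot>\<^sub>v (Q2 *\<^sub>v x)"
    using carr x unfolding A_mat_def P_def[symmetric] Q1_def[symmetric] Q2_def[symmetric]
    by (simp add: add_mult_distrib_mat_vec[of _ ?N ?N] smult_mat_mult_vec[of _ ?N ?N]
        assoc_add_vec[of _ ?N])
  then have "x \<bullet> (A_mat h w lam\<^sub>1 lam\<^sub>2 W\<^sub>1 W\<^sub>2 *\<^sub>v x) =
      x \<bullet> (P *\<^sub>v x) + lam\<^sub>1 * (x \<bullet> (Q1 *\<^sub>v x)) + lam\<^sub>2 * (x \<bullet> (Q2 *\<^sub>v x))"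
    using carr x by (simp add: scalar_prod_add_distrib[of _ ?N])
  also have "\<dots> = (?S *\<^sub>v x) \<bullet> (?S *\<^sub>v x) + lam\<^sub>1 * ((?G *\<^sub>v x) \<bullet> (W\<^sub>1 *\<^sub>v (?G *\<^sub>v x)))
      + lam\<^sub>2 * ((?R *\<^sub>v x) \<bullet> (W\<^sub>2 *\<^sub>v (?R *\<^sub>v x)))"
    unfolding P_def Q1_def Q2_def scalar_prod_transpose_mult_self[OF S x]
      scalar_prod_transpose_mult_mult[OF G W1(1) x] scalar_prod_transpose_mult_mult[OF R W2(1) x] ..
  \<comment> \<open>The smaller side is |M x|^2 as expanded by \<open>M_mat_sq\<close>.\<close>
  also have "\<dots> \<ge> (?S *\<^sub>v x) \<bullet> (?S *\<^sub>v x) + lam\<^sub>1 * (\<omega> * ((?G *\<^sub>v x) \<bullet> (?G *\<^sub>v x)))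
      + lam\<^sub>2 * (\<omega> * ((?R *\<^sub>v x) \<bullet> (?R *\<^sub>v x)))"
    using pos G R x
    by (intro add_mono mult_left_mono order_refl loewner_le_smult_one_form[OF W1(2,1)]
        loewner_le_smult_one_form[OF W2(2,1)]) auto
  finally show ?thesis
    using pos by (simp add: M_mat_sq[OF x] mult.assoc)
qed

section \<open>Fixed points for constant weights and their dependence on the data\<close>

theorem proposition6p5:
  fixes h w n :: nat
    and lam\<^sub>1 lam\<^sub>2 \<omega>min \<omega>max :: real
    and W\<^sub>1 W\<^sub>2 :: "real mat"
  assumes "h \<ge> 2" and "w \<ge> 2" and "n = h * w"
    and "lam\<^sub>1 > 0" and "lam\<^sub>2 > 0"
    and "0 < \<omega>min" and "\<omega>min \<le> \<omega>max" and "\<omega>max < 1"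
    and "W\<^sub>1 \<in> carrier_mat (2 * n) (2 * n)" and "diagonal_mat W\<^sub>1"
    and "W\<^sub>2 \<in> carrier_mat (2 * n) (2 * n)" and "diagonal_mat W\<^sub>2"
    and "\<omega>min \<cdot>\<^sub>m 1\<^sub>m (2 * n) \<preceq>\<^sub>L W\<^sub>1" and "W\<^sub>1 \<preceq>\<^sub>L \<omega>max \<cdot>\<^sub>m 1\<^sub>m (2 * n)"
    and "\<omega>min \<cdot>\<^sub>m 1\<^sub>m (2 * n) \<preceq>\<^sub>L W\<^sub>2" and "W\<^sub>2 \<preceq>\<^sub>L \<omega>max \<cdot>\<^sub>m 1\<^sub>m (2 * n)"
  shows "alpha h w lam\<^sub>1 lam\<^sub>2 \<omega>min > 0 \<and>
    (\<forall>f \<in> carrier_vec n. \<exists>!x. is_fixed_point h w lam\<^sub>1 lam\<^sub>2 (\<lambda>_. (W\<^sub>1, W\<^sub>2)) f x) \<and>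
    (\<forall>f\<^sub>1 \<in> carrier_vec n. \<forall>f\<^sub>2 \<in> carrier_vec n.
       l2norm_vec (fixed_point h w lam\<^sub>1 lam\<^sub>2 (\<lambda>_. (W\<^sub>1, W\<^sub>2)) f\<^sub>1
                   - fixed_point h w lam\<^sub>1 lam\<^sub>2 (\<lambda>_. (W\<^sub>1, W\<^sub>2)) f\<^sub>2)
       \<le> spectral_norm (S_mat h w) / alpha h w lam\<^sub>1 lam\<^sub>2 \<omega>min * l2norm_vec (f\<^sub>1 - f\<^sub>2))"
proof -
  let ?\<alpha> = "alpha h w lam\<^sub>1 lam\<^sub>2 \<omega>min"
  let ?M = "M_mat h w lam\<^sub>1 lam\<^sub>2 \<omega>min"
  define A where "A = A_mat h w lam\<^sub>1 lam\<^sub>2 W\<^sub>1 W\<^sub>2"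
  define S where "S = S_mat h w"
  note n = \<open>n = h * w\<close>
  have N: "0 < 3 * (h * w)" using assms(1,2) by simp
  have lam: "0 \<le> lam\<^sub>1 * \<omega>min" "0 < lam\<^sub>2 * \<omega>min" using assms(4-6) by simp_all
  have A: "A \<in> carrier_mat (3 * n) (3 * n)"
    unfolding A_def n using assms(9,11) n by (intro A_mat_carrier) auto
  have S: "S \<in> carrier_mat n (3 * n)" unfolding S_def n by (rule S_mat_carrier)
  note sigma = sigma_min_injective[OF M_mat_carrier[of h w lam\<^sub>1 lam\<^sub>2 \<omega>min] N
      M_mat_injective[OF _ lam], simplified]
  have alpha: "0 < ?\<alpha>" using sigma(1) by (simp add: alpha_def)
  have coercive: "?\<alpha> * (x \<bullet> x) \<le> x \<bullet> (A *\<^sub>v x)" if x: "x \<in> carrier_vec (3 * n)" for x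
  proof -
    have x': "x \<in> carrier_vec (3 * (h * w))" using x n by simp
    have "?\<alpha> * (x \<bullet> x) \<le> (?M *\<^sub>v x) \<bullet> (?M *\<^sub>v x)"
      unfolding alpha_def using sigma(2) x' by simp
    also have "\<dots> \<le> x \<bullet> (A *\<^sub>v x)"
      unfolding A_def using assms by (intro A_mat_form_ge_M_mat_sq[OF x']) auto
    finally show ?thesis .
  qed
  \<comment> \<open>Coercivity makes \<open>mat_inverse\<close> succeed, so \<open>the\<close> in
    \<open>T_op\<close> unwraps a genuine inverse.\<close>
  obtain B where B: "mat_inverse A = Some B" "B \<in> carrier_mat (3 * n) (3 * n)" "A * B = 1\<^sub>m (3 * n)"
    using invertible_imp_inverse[OF A coercive_imp_invertible[OF A alpha coercive]] by metis
  define x where "x f = B *\<^sub>v (transpose_mat S *\<^sub>v f)" for f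
  \<comment> \<open>A matrix-vector product takes its dimension from the matrix alone, so this holds
    for \<open>f\<close> of any length.\<close>
  have Stf: "transpose_mat S *\<^sub>v f \<in> carrier_vec (3 * n)" for f using S by (auto intro: carrier_vecI)
  have xc: "x f \<in> carrier_vec (3 * n)" for f
    unfolding x_def by (rule mult_mat_vec_carrier[OF B(2) Stf])
  \<comment> \<open>Constant weights make \<open>T_op\<close> constant in its argument, so its
    single value is the one fixed point; this settles existence and uniqueness together.\<close>
  have iff: "is_fixed_point h w lam\<^sub>1 lam\<^sub>2 (\<lambda>_. (W\<^sub>1, W\<^sub>2)) f y \<longleftrightarrow> y = x f" for f y
    using xc[of f] B(1) by (auto simp: is_fixed_point_def T_op_def x_def A_def S_def n)
  have fp: "fixed_point h w lam\<^sub>1 lam\<^sub>2 (\<lambda>_. (W\<^sub>1, W\<^sub>2)) f = x f" for f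
    by (simp add: fixed_point_def iff)
  have Ax: "A *\<^sub>v x f = transpose_mat S *\<^sub>v f" for f
    using assoc_mult_mat_vec[OF A B(2) Stf[of f]] B(3) Stf[of f] by (simp add: x_def)
  have "l2norm_vec (x f\<^sub>1 - x f\<^sub>2) \<le> spectral_norm S / ?\<alpha> * l2norm_vec (f\<^sub>1 - f\<^sub>2)"
    if f: "f\<^sub>1 \<in> carrier_vec n" "f\<^sub>2 \<in> carrier_vec n" for f\<^sub>1 f\<^sub>2
  proof (rule coercive_normal_equations_bound[OF A S _ _ alpha])
    show d: "x f\<^sub>1 - x f\<^sub>2 \<in> carrier_vec (3 * n)" using xc by simp
    show "f\<^sub>1 - f\<^sub>2 \<in> carrier_vec n" using f by simp
    show "?\<alpha> * ((x f\<^sub>1 - x f\<^sub>2) \<bullet> (x f\<^sub>1 - x f\<^sub>2)) \<le> (x f\<^sub>1 - x f\<^sub>2) \<bullet> (A *\<^sub>v (x f\<^sub>1 - x f\<^sub>2))"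
      by (rule coercive[OF d])
    have St: "transpose_mat S \<in> carrier_mat (3 * n) n" using S by simp
    \<comment> \<open>Both fixed points solve normal equations with the same matrix, so by linearity
      their difference solves them for the difference of the data.\<close>
    show "A *\<^sub>v (x f\<^sub>1 - x f\<^sub>2) = transpose_mat S *\<^sub>v (f\<^sub>1 - f\<^sub>2)"
      using mult_minus_distrib_mat_vec[OF A xc xc] mult_minus_distrib_mat_vec[OF St f] Ax
      by simp
  qed
  then show ?thesis using alpha by (simp add: iff fp S_def)
qed

end
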